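(* For every positive integer $n$, there exists a c-forest-Wilf equivalence class containing at least $2^{n-4}$ patterns of length $n$.
   Context: A rooted labeled forest on $[n]$ is an unordered forest on $n$ vertices, each component with a distinguished root, with distinct vertex labels from $[n]$. A pattern of length $k$ is a permutation of $[k]$. A consecutive instance of $\pi$ in a forest is a sequence of vertices $v_1,\dots,v_k$ with $v_i$ the parent of $v_{i+1}$ for all $i$ (a downward path) whose labels are in the same relative order as $\pi$. A forest consecutively avoids $\pi$ if it has no consecutive instance of $\pi$. Two patterns are c-forest-Wilf equivalent if for every $n\ge0$ the numbers of rooted labeled forests on $[n]$ consecutively avoiding each of them are equal; a c-forest-Wilf equivalence class is an equivalence class of patterns under this relation. *)

theory Defs
  imports Complex_Main
begin

definition is_pattern :: "nat \<Rightarrow> nat list \<Rightarrow> bool" where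
  "is_pattern k p \<longleftrightarrow> length p = k \<and> distinct p \<and> set p = {1..k}"

text \<open>A rooted labeled forest on [n], encoded by its parent map: par v = None iff v is a root
  (or v is not a vertex), par v = Some u iff u is the parent of v. The parent relation is acyclic.\<close>
definition rooted_forest :: "nat \<Rightarrow> (nat \<Rightarrow> nat option) \<Rightarrow> bool" where
  "rooted_forest n par \<longleftrightarrow>
     (\<forall>v. v \<notin> {1..n} \<longrightarrow> par v = None) \<and>
     (\<forall>v u. par v = Some u \<longrightarrow> u \<in> {1..n}) \<and>
     acyclic {(v, u). par v = Some u}"

definition consec_instance :: "(nat \<Rightarrow> nat option) \<Rightarrow> nat list \<Rightarrow> nat list \<Rightarrow> bool" where
  "consec_instance par pat vs \<longleftrightarrow>
     length vs = length pat \<and>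
     (\<forall>i. i + 1 < length vs \<longrightarrow> par (vs ! (i + 1)) = Some (vs ! i)) \<and>
     (\<forall>i < length vs. \<forall>j < length vs. vs ! i < vs ! j \<longleftrightarrow> pat ! i < pat ! j)"

definition consec_avoids :: "(nat \<Rightarrow> nat option) \<Rightarrow> nat list \<Rightarrow> bool" where
  "consec_avoids par pat \<longleftrightarrow> \<not> (\<exists>vs. consec_instance par pat vs)"

definition num_avoiding :: "nat \<Rightarrow> nat list \<Rightarrow> nat" where
  "num_avoiding n pat = card {par. rooted_forest n par \<and> consec_avoids par pat}"

definition c_forest_wilf_equiv :: "nat list \<Rightarrow> nat list \<Rightarrow> bool" where
  "c_forest_wilf_equiv sigma tau \<longleftrightarrow> (\<forall>n. num_avoiding n sigma = num_avoiding n tau)"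

definition cfw_class :: "nat list \<Rightarrow> nat list set" where
  "cfw_class sigma = {tau. (\<exists>k. is_pattern k tau) \<and> c_forest_wilf_equiv sigma tau}"

end

theory Submission
  imports Defs "HOL-Library.Infinite_Set"
begin

text \<open>
  Fix \<open>k \<ge> 5\<close>. The patterns considered begin with \<open>1, 2, m\<close> and continue with letters that are alternately
  smaller and larger than \<open>m\<close> (low, high, low, \<open>\<dots>\<close>), such that each low letter is the minimum or the maximum
  of itself and the later low letters, and likewise for the high letters. A choice of minimum or maximum
  is possible at each of \<open>k - 5\<close> places, and the complements double the number of patterns to \<open>2 ^ (k - 4)\<close>.

  The pattern may even be chosen separately for each possible label \<open>u\<close> of the third vertex of an
  occurrence, and the number of avoiding forests does not change when the choice at a single \<open>u\<close> changes.
  By inclusion-exclusion one counts forests with a set of marked occurrences, all with third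
  vertex \<open>u\<close>. Negating the choices at the positions \<open>j, j + 2, j + 4, \<dots>\<close> corresponds to reversing, below
  each marked vertex at position \<open>j\<close>, the order of the labels of the marked vertices at these positions.
  Each relabelled vertex keeps its unmarked children attached to its label, so only the parents of
  marked vertices change. Any other occurrence survives this: the only edge it can share with the
  marked ones is its first one, an ascent from a low to a high vertex, and its first vertex only has to
  lie below its second.
\<close>

section \<open>Reversing the order of a finite set\<close>

definition mirror :: "nat set \<Rightarrow> nat \<Rightarrow> nat" where
  "mirror X = (SOME r. (\<forall>x\<in>X. r x \<in> X \<and> r (r x) = x) \<and>
     (\<forall>x\<in>X. \<forall>y\<in>X. x < y \<longrightarrow> r y < r x) \<and> (\<forall>x. x \<notin> X \<longrightarrow> r x = x))"

text \<open>With \<open>h\<close> the increasing enumeration of \<open>X\<close> and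
  \<open>g\<close> the rank, sending rank \<open>i\<close> to rank \<open>?m - 1 - i\<close> meets
  all the conditions in the definition, so the \<open>SOME\<close> there really has a value.\<close>

lemma mirror:
  assumes "finite X"
  shows mirror_in: "x \<in> X \<Longrightarrow> mirror X x \<in> X"
    and mirror_mirror: "mirror X (mirror X x) = x"
    and mirror_less_iff: "x \<in> X \<Longrightarrow> y \<in> X \<Longrightarrow> mirror X y < mirror X x \<longleftrightarrow> x < y"
    and mirror_outside: "x \<notin> X \<Longrightarrow> mirror X x = x"
proof -
  obtain h where h: "bij_betw h {..<card X} X" and hm: "strict_mono_on {..<card X} h"
    using ex_bij_betw_strict_mono_card[OF assms] by auto
  let ?m = "card X"
  define g where "g = inv_into {..<?m} h"
  have g: "g x < ?m" "h (g x) = x" if "x \<in> X" for x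
    using that h unfolding g_def bij_betw_def
    by (metis lessThan_iff inv_into_into, metis f_inv_into_f)
  have gh: "g (h i) = i" if "i < ?m" for i
    using that h unfolding g_def bij_betw_def by (simp add: inv_into_f_f)
  have hin: "h i \<in> X" if "i < ?m" for i
    using that h unfolding bij_betw_def by auto
  have gm: "g x < g y" if "x \<in> X" "y \<in> X" "x < y" for x y
  proof (rule ccontr)
    assume "\<not> g x < g y"
    then have "h (g y) \<le> h (g x)"
      using g that strict_mono_onD[OF hm, of "g y" "g x"] by (cases "g x = g y") auto
    then show False using g that by simp
  qed
  define r where "r x = (if x \<in> X then h (?m - 1 - g x) else x)" for x
  have r1: "r x \<in> X \<and> r (r x) = x" if "x \<in> X" for x
  proof -
    have "?m - 1 - g x < ?m" using g(1)[OF that] by simp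
    then show ?thesis using that g(1)[OF that] g(2)[OF that] by (simp add: r_def hin gh)
  qed
  have r2: "r y < r x" if "x \<in> X" "y \<in> X" "x < y" for x y
  proof -
    have "?m - 1 - g y < ?m - 1 - g x" "?m - 1 - g x < ?m" using that g gm[OF that] by fastforce+
    then show ?thesis using that strict_mono_onD[OF hm, of "?m - 1 - g y" "?m - 1 - g x"]
      by (simp add: r_def)
  qed
  have ex: "\<exists>r. (\<forall>x\<in>X. r x \<in> X \<and> r (r x) = x) \<and>
     (\<forall>x\<in>X. \<forall>y\<in>X. x < y \<longrightarrow> r y < r x) \<and> (\<forall>x. x \<notin> X \<longrightarrow> r x = x)"
    using r1 r2 by (intro exI[of _ r] conjI) (blast, blast, simp add: r_def)
  note P = someI_ex[OF ex, folded mirror_def]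
  show "x \<in> X \<Longrightarrow> mirror X x \<in> X" "x \<notin> X \<Longrightarrow> mirror X x = x"
    using P by blast+
  show "mirror X (mirror X x) = x" using P by (cases "x \<in> X") auto
  show "mirror X y < mirror X x \<longleftrightarrow> x < y" if "x \<in> X" "y \<in> X"
    using P that by (metis linorder_less_linear order_less_asym)
qed

section \<open>Shapes of paths\<close>

text \<open>Positions are counted from 0: position 2 carries the letter \<open>m\<close>, odd positions from 3 on the low and even
  positions the high letters. The bit \<open>e i\<close> tells whether the letter at position \<open>i \<ge> 3\<close> is the minimum among
  itself and the later letters of its kind.\<close>

definition below :: "(nat \<Rightarrow> bool) \<Rightarrow> nat \<Rightarrow> nat \<Rightarrow> bool" where
  "below e i j \<longleftrightarrow> i < 2 \<or> i = 2 \<and> even j \<or> 3 \<le> i \<and> (if even (i + j) then e i else odd i)"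

text \<open>A comparison is prescribed for every pair of positions, so a shape together with a
  length determines the whole relative order without naming values.\<close>

definition shape :: "(nat \<Rightarrow> bool) \<Rightarrow> nat list \<Rightarrow> bool" where
  "shape e vs \<longleftrightarrow>
     (\<forall>i j. i < j \<longrightarrow> j < length vs \<longrightarrow> (if below e i j then vs ! i < vs ! j else vs ! j < vs ! i))"

definition down_path :: "(nat \<Rightarrow> nat option) \<Rightarrow> nat list \<Rightarrow> bool" where
  "down_path par vs \<longleftrightarrow> (\<forall>i. i + 1 < length vs \<longrightarrow> par (vs ! (i + 1)) = Some (vs ! i))"

definition flip :: "nat \<Rightarrow> (nat \<Rightarrow> bool) \<Rightarrow> nat \<Rightarrow> bool" where
  "flip j e i \<longleftrightarrow> (e i \<noteq> (j \<le> i \<and> even (i + j)))"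

lemma flip_flip [simp]: "flip j (flip j e) = e"
  by (auto simp: flip_def fun_eq_iff)

lemma shape_nth_neq: "shape e vs \<Longrightarrow> i < length vs \<Longrightarrow> j < length vs \<Longrightarrow> i \<noteq> j \<Longrightarrow> vs ! i \<noteq> vs ! j"
  unfolding shape_def by (metis less_irrefl linorder_neqE_nat)

text \<open>A vertex has only one parent, so two downward paths that meet agree on the way up for as
  long as both extend.\<close>

lemma down_path_up:
  assumes "down_path par vs" "down_path par ws" "vs ! a = ws ! b" "a < length vs" "b < length ws"
  shows "t \<le> a \<Longrightarrow> t \<le> b \<Longrightarrow> vs ! (a - t) = ws ! (b - t)"
proof (induction t)
  case 0 then show ?case using assms by simp
next
  case (Suc t)
  have "par (vs ! (a - Suc t + 1)) = Some (vs ! (a - Suc t))"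
       "par (ws ! (b - Suc t + 1)) = Some (ws ! (b - Suc t))"
    using Suc assms unfolding down_path_def by auto
  moreover have "a - Suc t + 1 = a - t" "b - Suc t + 1 = b - t" using Suc.prems by auto
  ultimately show ?case using Suc by simp
qed

section \<open>The involution on forests with marked occurrences\<close>

text \<open>Outside this set \<open>twist\<close> leaves every parent unchanged.\<close>

definition tails :: "nat list set \<Rightarrow> nat set" where
  "tails S = {vs ! i | vs i. vs \<in> S \<and> 3 \<le> i \<and> i < length vs}"

text \<open>If \<open>x\<close> sits at one of the positions \<open>j, j + 2, ...\<close> of a
  marked occurrence, its block gathers the vertices at these positions in all marked occurrences
  through the same vertex at position \<open>j\<close>. Every other \<open>x\<close> gets the empty
  block and is fixed by \<open>swap\<close>.\<close>

definition block :: "nat \<Rightarrow> nat list set \<Rightarrow> nat \<Rightarrow> nat set" where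
  "block j S x = {ws ! b | vs ws a b. vs \<in> S \<and> ws \<in> S \<and> vs ! j = ws ! j \<and> vs ! a = x \<and>
     j \<le> a \<and> a < length vs \<and> even (a + j) \<and> j \<le> b \<and> b < length ws \<and> even (b + j)}"

definition swap :: "nat \<Rightarrow> nat list set \<Rightarrow> nat \<Rightarrow> nat" where
  "swap j S x = mirror (block j S x) x"

text \<open>On \<open>tails S\<close> the parent map is conjugated by the relabelling. Elsewhere it
  is untouched, so an unmarked child keeps the label of its parent even when that label has
  moved.\<close>

definition twist :: "nat \<Rightarrow> nat list set \<Rightarrow> (nat \<Rightarrow> nat option) \<Rightarrow> nat \<Rightarrow> nat option" where
  "twist j S par x = (if x \<in> tails S then map_option (swap j S) (par (swap j S x)) else par x)"

definition marked :: "nat \<Rightarrow> nat \<Rightarrow> (nat \<Rightarrow> bool) \<Rightarrow> (nat \<Rightarrow> nat option) \<Rightarrow> nat list set \<Rightarrow> bool" where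
  "marked k u e par S \<longleftrightarrow> finite S \<and>
     (\<forall>vs\<in>S. length vs = k \<and> down_path par vs \<and> vs ! 2 = u \<and> shape e vs)"

context
  fixes k u j :: nat and e :: "nat \<Rightarrow> bool" and par :: "nat \<Rightarrow> nat option" and S :: "nat list set"
  assumes m: "marked k u e par S" and k: "5 \<le> k" and j: "3 \<le> j"
begin

section \<open>How marked occurrences with a common third vertex overlap\<close>

lemma marked_facts: "vs \<in> S \<Longrightarrow> length vs = k" "vs \<in> S \<Longrightarrow> down_path par vs" "vs \<in> S \<Longrightarrow> vs ! 2 = u"
  "vs \<in> S \<Longrightarrow> shape e vs" "finite S"
  using m unfolding marked_def by auto

text \<open>Both occurrences have \<open>u\<close> at position 2, and the ancestors of
  \<open>u\<close> are determined.\<close>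

lemma head_eq: 
  assumes "vs \<in> S" "ws \<in> S" "c \<le> 2"
  shows "vs ! c = ws ! c"
  using down_path_up[of par vs ws 2 2 "2 - c"] assms marked_facts k by auto

text \<open>If \<open>a < b\<close>, climbing \<open>a - 2\<close> steps from the common vertex
  reaches \<open>u\<close> along \<open>vs\<close>, but a position beyond 2 along \<open>ws\<close>,
  although \<open>ws\<close> already has \<open>u\<close> at position 2 and its vertices are
  distinct.\<close>

lemma level_eq:
  assumes "vs \<in> S" "ws \<in> S" "2 \<le> a" "a < k" "2 \<le> b" "b < k" "vs ! a = ws ! b"
  shows "a = b"
proof -
  have *: False if "vs \<in> S" "ws \<in> S" "2 \<le> a" "a < b" "b < k" "vs ! a = ws ! b" for vs ws a b
  proof -
    have "vs ! (a - (a - 2)) = ws ! (b - (a - 2))"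
      using down_path_up[of par vs ws a b "a - 2"] that marked_facts by auto
    then have "ws ! 2 = ws ! (b - (a - 2))" using that marked_facts by auto
    moreover have "b - (a - 2) \<noteq> 2" "b - (a - 2) < k" using that by auto
    ultimately show False using shape_nth_neq[of e ws 2 "b - (a - 2)"] that marked_facts k by auto
  qed
  show ?thesis using *[of vs ws a b] *[of ws vs b a] assms by (metis linorder_neqE_nat)
qed

lemma prefix_eq:
  assumes "vs \<in> S" "ws \<in> S" "vs ! a = ws ! a" "a < k" "c \<le> a"
  shows "vs ! c = ws ! c"
  using down_path_up[of par vs ws a a "a - c"] assms marked_facts by auto

lemma head_notin_tails:
  assumes "vs \<in> S" "c \<le> 2" shows "vs ! c \<notin> tails S"
proof
  assume "vs ! c \<in> tails S"
  then obtain ws i where w: "ws \<in> S" "3 \<le> i" "i < length ws" "vs ! c = ws ! i" unfolding tails_def by auto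
  then have "ws ! c = ws ! i" using head_eq assms by metis
  then show False using shape_nth_neq[of e ws c i] w assms marked_facts by auto
qed

lemma tailsI: "vs \<in> S \<Longrightarrow> 3 \<le> i \<Longrightarrow> i < k \<Longrightarrow> vs ! i \<in> tails S"
  unfolding tails_def using marked_facts by auto

lemma tails_index: "vs \<in> S \<Longrightarrow> i < k \<Longrightarrow> vs ! i \<in> tails S \<longleftrightarrow> 3 \<le> i"
  using tailsI head_notin_tails by (metis not_less_eq_eq numeral_2_eq_2 numeral_3_eq_3)

section \<open>Blocks and the relabelling that reverses each of them\<close>

lemma block_subset: "block j S x \<subseteq> tails S"
  unfolding block_def tails_def using j by force

lemma finite_block: "finite (block j S x)"
proof (rule finite_subset[OF block_subset])
  have "tails S \<subseteq> (\<Union>vs\<in>S. set vs)" unfolding tails_def by auto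
  then show "finite (tails S)" using marked_facts(5) finite_subset by blast
qed

text \<open>The occurrence through \<open>vs ! a\<close> used in the definition of the block is
  immaterial: any other one has this vertex at the same level, and hence shares the vertex at
  position \<open>j\<close> above it.\<close>

lemma block_eq:
  assumes "vs \<in> S" "j \<le> a" "a < k" "even (a + j)"
  shows "block j S (vs ! a) = {ws ! b | ws b. ws \<in> S \<and> ws ! j = vs ! j \<and> j \<le> b \<and> b < k \<and> even (b + j)}"
    (is "_ = ?R")
proof
  show "?R \<subseteq> block j S (vs ! a)" 
  proof
    fix y assume "y \<in> ?R"
    then obtain ws b where "ws \<in> S" "vs ! j = ws ! j" "j \<le> b" "b < length ws" "even (b + j)" "y = ws ! b"
      using marked_facts by auto
    then show "y \<in> block j S (vs ! a)" unfolding block_def using assms marked_facts(1)[OF assms(1)] by blast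
  qed
  show "block j S (vs ! a) \<subseteq> ?R"
  proof
    fix y assume "y \<in> block j S (vs ! a)"
    then obtain vs' ws a' b where *: "vs' \<in> S" "ws \<in> S" "vs' ! j = ws ! j" "vs' ! a' = vs ! a"
     "j \<le> a'" "a' < k" "even (a' + j)" "j \<le> b" "b < k" "even (b + j)" "y = ws ! b"
      unfolding block_def using marked_facts by auto
    have "a' = a" using level_eq[of vs' vs a' a] * assms j by auto
    then have "vs' ! j = vs ! j" using prefix_eq[of vs' vs a j] * assms by auto
    then show "y \<in> ?R" using * by auto
  qed
qed

lemma block_empty:
  assumes "vs \<in> S" "a < k" "\<not> (j \<le> a \<and> even (a + j))"
  shows "block j S (vs ! a) = {}"
proof (rule ccontr)
  assume "block j S (vs ! a) \<noteq> {}"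
  then obtain ws b where w: "ws \<in> S" "ws ! b = vs ! a" "j \<le> b" "b < k" "even (b + j)"
    unfolding block_def using marked_facts by auto
  then have "3 \<le> a" using tails_index[of vs a] tails_index[of ws b] assms j by auto
  then show False using level_eq[of ws vs b a] w assms j by auto
qed

lemma block_outside: "x \<notin> tails S \<Longrightarrow> block j S x = {}"
  unfolding block_def tails_def using j by force

text \<open>Nonempty blocks are thus the classes of a partition, which lets \<open>swap\<close> act
  on each of them separately and be an involution.\<close>

lemma block_block: "y \<in> block j S x \<Longrightarrow> block j S y = block j S x"
proof -
  assume "y \<in> block j S x"
  then obtain vs ws a b where *: "vs \<in> S" "ws \<in> S" "vs ! j = ws ! j" "vs ! a = x"
     "j \<le> a" "a < k" "even (a + j)" "j \<le> b" "b < k" "even (b + j)" "y = ws ! b"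
      unfolding block_def using marked_facts by auto
  then show ?thesis using block_eq[of vs a] block_eq[of ws b] by auto
qed

lemma block_self: "block j S x \<noteq> {} \<Longrightarrow> x \<in> block j S x"
  unfolding block_def by blast

lemma swap_fixed: "block j S x = {} \<Longrightarrow> swap j S x = x"
  unfolding swap_def by (simp add: mirror_outside)

lemma swap_in: "block j S x \<noteq> {} \<Longrightarrow> swap j S x \<in> block j S x"
  unfolding swap_def using mirror_in[OF finite_block] block_self by blast

lemma block_swap: "block j S (swap j S x) = block j S x"
  using swap_fixed swap_in block_block by metis

lemma swap_swap [simp]: "swap j S (swap j S x) = x"
  using block_swap mirror_mirror[OF finite_block] unfolding swap_def by metis

lemma swap_eq_iff: "swap j S x = swap j S y \<longleftrightarrow> x = y"
  using swap_swap by metis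

lemma swap_nth_good:
  assumes "vs \<in> S" "j \<le> a" "a < k" "even (a + j)"
  obtains ws b where "ws \<in> S" "ws ! j = vs ! j" "j \<le> b" "b < k" "even (b + j)"
    "swap j S (vs ! a) = ws ! b"
proof -
  have "vs ! a \<in> block j S (vs ! a)" using block_eq assms by auto
  then have "swap j S (vs ! a) \<in> block j S (vs ! a)" using swap_in by blast
  then show ?thesis using block_eq assms that by auto
qed

lemma swap_nth_bad:
  assumes "vs \<in> S" "a < k" "\<not> (j \<le> a \<and> even (a + j))"
  shows "swap j S (vs ! a) = vs ! a"
  using assms block_empty swap_fixed by simp

text \<open>A block may contain vertices of different levels, but all these levels have the parity
  of \<open>j\<close>; so a vertex can change level but never passes between low and high.\<close>

lemma swap_nth:
  assumes "vs \<in> S" "3 \<le> a" "a < k"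
  obtains ws b where "ws \<in> S" "3 \<le> b" "b < k" "even (a + b)" "swap j S (vs ! a) = ws ! b"
proof (cases "j \<le> a \<and> even (a + j)")
  case True
  then obtain ws b where w: "ws \<in> S" "j \<le> b" "b < k" "even (b + j)" "swap j S (vs ! a) = ws ! b"
    using swap_nth_good[OF assms(1) _ assms(3)] by metis
  then have "3 \<le> b" "even (a + b)" using True j by auto
  with w show ?thesis using that by blast
next
  case False
  then have "swap j S (vs ! a) = vs ! a" using swap_nth_bad assms by blast
  then show ?thesis using that[OF assms] by simp
qed

lemma swap_tails: "swap j S x \<in> tails S \<longleftrightarrow> x \<in> tails S"
  by (metis block_subset block_outside block_self block_swap subsetD swap_fixed)

section \<open>The effect of the relabelling on marked occurrences\<close>

lemma tail_side:
  assumes "vs \<in> S" "3 \<le> a" "a < k"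
  shows "odd a \<Longrightarrow> vs ! a < u" "even a \<Longrightarrow> u < vs ! a" "c < 2 \<Longrightarrow> vs ! c < vs ! a"
proof -
  have s: "shape e vs" and l: "length vs = k" and u: "vs ! 2 = u" using assms marked_facts by auto
  show "odd a \<Longrightarrow> vs ! a < u" "even a \<Longrightarrow> u < vs ! a"
    using s[unfolded shape_def, rule_format, of 2 a] assms l u unfolding below_def by auto
  show "c < 2 \<Longrightarrow> vs ! c < vs ! a"
    using s[unfolded shape_def, rule_format, of c a] assms l u unfolding below_def by auto
qed

text \<open>Comparisons with the first three vertices, or between a low and a high vertex, depend
  only on the parity of positions, which \<open>swap\<close> keeps. Among letters of one kind, the
  order is reversed exactly between two positions in \<open>j, j + 2, ...\<close>, matching the bits
  that \<open>flip\<close> negates.\<close>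

lemma shape_swap:
  assumes "vs \<in> S"
  shows "shape (flip j e) (map (swap j S) vs)"
  unfolding shape_def
proof (intro allI impI)
  fix a b assume ab: "a < b" "b < length (map (swap j S) vs)"
  have l: "length vs = k" using marked_facts assms by auto
  have bk: "b < k" and ak: "a < k" using ab l by auto
  let ?s = "swap j S"
  have orig: "if below e a b then vs ! a < vs ! b else vs ! b < vs ! a"
    using marked_facts(4)[OF assms] ab l unfolding shape_def by auto
  have small: "?s (vs ! c) = vs ! c" if "c < 3" for c
    using that swap_nth_bad[of vs c] assms j k by auto
  have "if below (flip j e) a b then ?s (vs ! a) < ?s (vs ! b) else ?s (vs ! b) < ?s (vs ! a)"
  proof (cases "b < 3")
    case True
    then show ?thesis using orig small ab by (auto simp: below_def)
  next
    case b3: False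
    show ?thesis
    proof (cases "a < 3")
      case True
      obtain ws c where w: "ws \<in> S" "3 \<le> c" "c < k" "even (b + c)" "?s (vs ! b) = ws ! c"
        using swap_nth[of vs b] assms b3 bk by auto
      have "ws ! a = vs ! a" using head_eq[of ws vs a] w(1) assms True by simp
      moreover have "ws ! 2 = u" using w marked_facts by auto
      ultimately show ?thesis using tail_side[of ws c] tail_side(3)[of ws c a] w True small[OF True]
        by (cases "a = 2") (auto simp: below_def)
    next
      case a3: False
      show ?thesis
      proof (cases "even (a + b)")
        case False
        obtain ws c where w: "ws \<in> S" "3 \<le> c" "c < k" "even (b + c)" "?s (vs ! b) = ws ! c"
          using swap_nth[of vs b] assms b3 bk by auto
        obtain ws' c' where w': "ws' \<in> S" "3 \<le> c'" "c' < k" "even (a + c')" "?s (vs ! a) = ws' ! c'"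
          using swap_nth[of vs a] assms a3 ak by auto
        show ?thesis using tail_side[of ws c] tail_side[of ws' c'] w w' False a3
          by (cases "odd a") (auto simp: below_def)
      next
        case ev: True
        show ?thesis
        proof (cases "j \<le> b \<and> even (b + j)")
          case False
          then have fb: "\<not> (j \<le> a \<and> even (a + j))" using ev ab by auto
          then show ?thesis
            using orig swap_nth_bad[OF assms bk False] swap_nth_bad[OF assms ak fb] a3 ev
            by (auto simp: below_def flip_def)
        next
          case gb: True
          show ?thesis
          proof (cases "j \<le> a")
            case True
            then have ga: "j \<le> a \<and> even (a + j)" using gb ev by auto
            \<comment> \<open>Both vertices lie in one block, so their order is reversed, and the
              bit at \<open>a\<close> is negated as well.\<close>
            have "block j S (vs ! a) = block j S (vs ! b)"
              using block_eq[OF assms] ga gb ak bk by auto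
            moreover have "vs ! a \<in> block j S (vs ! a)" "vs ! b \<in> block j S (vs ! a)"
              using block_eq[of vs a] assms ga gb ak bk by auto
            ultimately have "?s (vs ! a) < ?s (vs ! b) \<longleftrightarrow> vs ! b < vs ! a"
              "?s (vs ! b) < ?s (vs ! a) \<longleftrightarrow> vs ! a < vs ! b"
              unfolding swap_def using mirror_less_iff[OF finite_block] by metis+
            then show ?thesis using orig a3 ev ga by (auto simp: below_def flip_def)
          next
            case False
            then have fa: "?s (vs ! a) = vs ! a" using swap_nth_bad assms ak by auto
            \<comment> \<open>The later vertex may move into another marked occurrence
              \<open>ws\<close>. Since \<open>ws\<close> agrees with \<open>vs\<close> down to
              position \<open>j\<close>, it contains \<open>vs ! a\<close> too, and its own shape
              supplies the comparison by the same bit \<open>e a\<close>.\<close>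
            obtain ws c where w: "ws \<in> S" "ws ! j = vs ! j" "j \<le> c" "c < k" "even (c + j)"
              "?s (vs ! b) = ws ! c" using swap_nth_good[of vs b] assms gb bk by auto
            have "ws ! a = vs ! a" using prefix_eq[of ws vs j a] w assms False by auto
            moreover have "if below e a c then ws ! a < ws ! c else ws ! c < ws ! a"
              using marked_facts(4)[OF w(1)] marked_facts(1)[OF w(1)] w False unfolding shape_def by auto
            moreover have "below e a c = below (flip j e) a b"
              using w gb ev a3 False by (auto simp: below_def flip_def)
            ultimately show ?thesis using fa w(6) by metis
          qed
        qed
      qed
    qed
  qed
  then show "if below (flip j e) a b then map ?s vs ! a < map ?s vs ! b
       else map ?s vs ! b < map ?s vs ! a"
    using ab l by simp
qed

text \<open>Edges with lower end at position 3 or beyond are conjugated by \<open>swap\<close>; for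
  the edges above, both ends are fixed and the child lies outside \<open>tails S\<close>. At the
  junction, \<open>u\<close> is fixed as well.\<close>

lemma down_path_twist:
  assumes "vs \<in> S"
  shows "down_path (twist j S par) (map (swap j S) vs)"
  unfolding down_path_def
proof (intro allI impI)
  fix i assume i: "i + 1 < length (map (swap j S) vs)"
  have l: "length vs = k" using marked_facts assms by auto
  have p: "par (vs ! (i + 1)) = Some (vs ! i)" using marked_facts(2)[OF assms] i l unfolding down_path_def by auto
  show "twist j S par (map (swap j S) vs ! (i + 1)) = Some (map (swap j S) vs ! i)"
  proof (cases "3 \<le> i + 1")
    case True
    then show ?thesis using p i l assms unfolding twist_def
      by (simp add: swap_tails tails_index)
  next
    case False
    then show ?thesis using p i l assms unfolding twist_def
      using swap_nth_bad[of vs i] swap_nth_bad[of vs "i+1"] j by (simp add: tails_index)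
  qed
qed

lemma marked_twist: "marked k u (flip j e) (twist j S par) (map (swap j S) ` S)"
  unfolding marked_def
proof (intro conjI ballI)
  fix vs' assume "vs' \<in> map (swap j S) ` S"
  then obtain vs where vs: "vs \<in> S" "vs' = map (swap j S) vs" by auto
  then show "length vs' = k" using marked_facts by auto
  show "down_path (twist j S par) vs'" "shape (flip j e) vs'" using vs down_path_twist shape_swap by auto
  show "vs' ! 2 = u" using vs marked_facts k swap_nth_bad[of vs 2] j by auto
qed (use marked_facts in auto)

lemma tails_twist: "tails (map (swap j S) ` S) = tails S"
proof -
  have "tails (map (swap j S) ` S) = swap j S ` tails S"
    unfolding tails_def by (auto simp: image_iff) (metis length_map nth_map)+
  also have "\<dots> = tails S"
    using swap_tails by (force simp: image_iff intro: bexI[of _ "swap j S _"])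
  finally show ?thesis .
qed

text \<open>Relabelling the marked set transports blocks along \<open>swap\<close>, and
  \<open>swap\<close> permutes each block. Hence the new marked set yields the same
  \<open>swap\<close>, which makes the whole construction an involution.\<close>

lemma block_twist: "block j (map (swap j S) ` S) x = block j S x"
proof -
  let ?s = "swap j S"
  have jl: "j < length vs" if "j \<le> a" "a < length vs" for vs :: "nat list" and a using that by auto
  have "block j (map ?s ` S) x = ?s ` block j S (?s x)"
  proof (intro set_eqI iffI)
    fix y assume "y \<in> block j (map ?s ` S) x"
    then obtain vs ws a b where *: "vs \<in> S" "ws \<in> S" "map ?s vs ! j = map ?s ws ! j" "map ?s vs ! a = x"
     "j \<le> a" "a < length vs" "even (a + j)" "j \<le> b" "b < length ws" "even (b + j)" "y = map ?s ws ! b"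
      unfolding block_def by auto
    then have "vs ! j = ws ! j" "vs ! a = ?s x" using jl swap_eq_iff by auto
    then have "ws ! b \<in> block j S (?s x)" unfolding block_def using * by blast
    then show "y \<in> ?s ` block j S (?s x)" using * by auto
  next
    fix y assume "y \<in> ?s ` block j S (?s x)"
    then obtain vs ws a b where *: "vs \<in> S" "ws \<in> S" "vs ! j = ws ! j" "vs ! a = ?s x"
     "j \<le> a" "a < length vs" "even (a + j)" "j \<le> b" "b < length ws" "even (b + j)" "y = ?s (ws ! b)"
      unfolding block_def by auto
    have "map ?s vs \<in> map ?s ` S" "map ?s ws \<in> map ?s ` S" "map ?s vs ! j = map ?s ws ! j"
      "map ?s vs ! a = x" "y = map ?s ws ! b" "a < length (map ?s vs)" "b < length (map ?s ws)" using * jl by auto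
    then show "y \<in> block j (map ?s ` S) x" unfolding block_def
      using *(5,7,8,10) by blast
  qed
  also have "\<dots> = ?s ` block j S x" by (simp add: block_swap)
  also have "\<dots> = block j S x"
  proof -
    have "?s y \<in> block j S x" if "y \<in> block j S x" for y
      using that by (metis block_block block_self block_swap empty_iff swap_in)
    then show ?thesis by (force simp: image_iff intro: bexI[of _ "?s _"])
  qed
  finally show ?thesis .
qed

lemma swap_twist: "swap j (map (swap j S) ` S) = swap j S"
proof
  fix x
  show "swap j (map (swap j S) ` S) x = swap j S x"
    using block_twist[of x] by (simp only: swap_def[of j "map (swap j S) ` S"] swap_def[of j S x])
qed

lemma twist_twist: "twist j (map (swap j S) ` S) (twist j S par) = par"
  unfolding fun_eq_iff twist_def swap_twist tails_twist
  by (auto simp: swap_tails option.map_comp o_def option.map_ident)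

lemma map_swap_twist: "map (swap j (map (swap j S) ` S)) ` map (swap j S) ` S = S"
  unfolding swap_twist by (simp add: image_image o_def)

end

lemma down_path_step: "down_path par vs \<Longrightarrow> 0 < i \<Longrightarrow> i < length vs \<Longrightarrow> par (vs ! i) = Some (vs ! (i - 1))"
  unfolding down_path_def by (metis Suc_eq_plus1 Suc_pred')

section \<open>Occurrences that are not marked\<close>

text \<open>This retains only what unmarked occurrences see of the marked vertices: climbing from
  \<open>P\<close> switches sides of \<open>u\<close> at each step until it arrives at
  \<open>u\<close> from below. It holds before and after \<open>twist\<close> with the same
  \<open>P\<close>.\<close>

definition alternating :: "(nat \<Rightarrow> nat option) \<Rightarrow> nat \<Rightarrow> nat set \<Rightarrow> bool" where
  "alternating par u P \<longleftrightarrow> u \<notin> P \<and>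
     (\<forall>x\<in>P. \<exists>y. par x = Some y \<and> (y = u \<and> x < u \<or> y \<in> P \<and> (x < u \<longleftrightarrow> u < y)))"

lemma alternating_tails:
  assumes m: "marked k u e par S" and k: "5 \<le> k"
  shows "alternating par u (tails S)"
  unfolding alternating_def
proof (intro conjI ballI)
  note marked_facts = marked_facts[OF m k order_refl]
  show "u \<notin> tails S"
  proof
    assume u: "u \<in> tails S"
    then obtain vs where vs: "vs \<in> S" unfolding tails_def by auto
    then show False using head_notin_tails[OF m k order_refl, of vs 2] marked_facts u by auto
  qed
  fix x assume "x \<in> tails S"
  then obtain vs i where vs: "vs \<in> S" "3 \<le> i" "i < k" "x = vs ! i"
    using marked_facts unfolding tails_def by auto
  have p: "par x = Some (vs ! (i - 1))"
    using marked_facts(2)[OF vs(1), unfolded down_path_def, rule_format, of "i - 1"] vs marked_facts(1) by simp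
  note s = tail_side[OF m k order_refl vs(1)]
  show "\<exists>y. par x = Some y \<and> (y = u \<and> x < u \<or> y \<in> tails S \<and> (x < u \<longleftrightarrow> u < y))"
  proof (cases "i = 3")
    case True
    then show ?thesis using p s(1)[of 3] vs marked_facts(3) k by auto
  next
    case False
    then have i: "3 \<le> i - 1" "i - 1 < k" using vs by auto
    have "vs ! (i - 1) \<in> tails S" using tailsI[OF m k order_refl vs(1)] False vs by auto
    moreover have "x < u \<longleftrightarrow> u < vs ! (i - 1)"
    proof (cases "even i")
      case True
      then have "odd (i - 1)" using i by auto
      then show ?thesis using True s(2)[of i] s(1)[of "i - 1"] vs i by auto
    next
      case False
      then have "even (i - 1)" using i by auto
      then show ?thesis using False s(1)[of i] s(2)[of "i - 1"] vs i by auto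
    qed
    ultimately show ?thesis using p by auto
  qed
qed

text \<open>The two ascents ending at \<open>u\<close> will exclude that an occurrence with another
  third vertex passes through \<open>u\<close> and then descends into the marked vertices.\<close>

lemma marked_head:
  assumes m: "marked k u e par S" and k: "5 \<le> k" and "S \<noteq> {}"
  shows "\<exists>p q. par u = Some p \<and> par p = Some q \<and> q < p \<and> p < u"
proof -
  note marked_facts = marked_facts[OF m k order_refl]
  obtain vs where vs: "vs \<in> S" using assms by auto
  have "par (vs ! 2) = Some (vs ! 1)" "par (vs ! 1) = Some (vs ! 0)"
    using down_path_step[OF marked_facts(2)[OF vs], of 2] down_path_step[OF marked_facts(2)[OF vs], of 1] marked_facts(1)[OF vs] k
    by auto
  moreover have "vs ! 0 < vs ! 1" "vs ! 1 < vs ! 2"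
    using marked_facts(1)[OF vs] marked_facts(4)[OF vs, unfolded shape_def, rule_format, of 0 1]
      marked_facts(4)[OF vs, unfolded shape_def, rule_format, of 1 2] k by (auto simp: below_def)
  ultimately show ?thesis using marked_facts(3)[OF vs] by auto
qed

text \<open>No vertex of \<open>ws\<close> from position 2 on lies in \<open>P\<close>, so only the
  edge between the first two vertices can be affected. If it is, the first vertex is replaced by the
  new parent of the second.\<close>

lemma transfer_occurrence:
  assumes alt: "alternating par u P" and alt': "alternating par' u P"
    and same: "\<And>x. x \<notin> P \<Longrightarrow> par' x = par x"
    and head: "par u = Some p" "par p = Some q" "q < p" "p < u"
    and ws: "length ws = k" "5 \<le> k" "down_path par ws" "shape e ws" "ws ! 2 \<noteq> u"
  shows "\<exists>ws'. length ws' = k \<and> down_path par' ws' \<and> shape e ws' \<and> ws' ! 2 = ws ! 2"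
proof -
  note step = down_path_step[OF ws(3)]
  note lt = ws(4)[unfolded shape_def, rule_format]
  have lt1: "ws ! 1 < ws ! 2" "ws ! 0 < ws ! 1" using lt[of 1 2] lt[of 0 1] ws by (auto simp: below_def)
  have altD: "\<exists>y. par x = Some y \<and> (y = u \<and> x < u \<or> y \<in> P \<and> (x < u \<longleftrightarrow> u < y))" if "x \<in> P" for x
    using alt that unfolding alternating_def by blast
  have uP: "u \<notin> P" using alt unfolding alternating_def by blast
  \<comment> \<open>A vertex of \<open>P\<close> below \<open>u\<close> has a larger parent, and one
    above \<open>u\<close> has its parent in \<open>P\<close> below \<open>u\<close>. So two
    consecutive ascents cannot end in \<open>P\<close>.\<close>
  have P2: "ws ! 2 \<notin> P"
  proof
    assume 2: "ws ! 2 \<in> P"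
    from altD[OF this] step[of 2] have "ws ! 1 = u \<and> ws ! 2 < u \<or> ws ! 1 \<in> P \<and> (ws ! 2 < u \<longleftrightarrow> u < ws ! 1)"
      using ws by auto
    then have 1: "ws ! 1 \<in> P" "ws ! 1 \<le> u" using lt1 by linarith+
    from altD[OF 1(1)] step[of 1] have "ws ! 0 = u \<and> ws ! 1 < u \<or> ws ! 0 \<in> P \<and> (ws ! 1 < u \<longleftrightarrow> u < ws ! 0)"
      using ws by auto
    then show False using 1 lt1 uP by (cases "ws ! 1 = u") auto
  qed
  have far: "ws ! i \<notin> P" if "2 \<le> i" "i < k" for i
    using that
  proof (induction i rule: nat_induct_at_least)
    case base then show ?case using P2 by simp
  next
    case (Suc i)
    show ?case
    proof
      assume "ws ! Suc i \<in> P"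
      \<comment> \<open>The parent is outside \<open>P\<close> by induction, which leaves only
        \<open>u\<close> itself.\<close>
      from altD[OF this] step[of "Suc i"] Suc ws have iu: "ws ! i = u" "ws ! Suc i < ws ! i" by auto
      then have i3: "3 \<le> i" using ws(5) Suc by (cases "i = 2") auto
      have "ws ! i < ws ! Suc i" if "odd i"
        using lt[of i "Suc i"] Suc ws that i3 by (auto simp: below_def)
      with iu have "even i" by auto
      then have i4: "4 \<le> i" using i3 by (cases "i = 3") auto
      \<comment> \<open>The path arrives at \<open>u\<close> by its ascent from \<open>q\<close> to
        \<open>p\<close>. But position \<open>i - 1\<close> is low and position \<open>i - 2\<close>
        is high or equal to 2, so the shape demands a descent there.\<close>
      have "par (ws ! i) = Some (ws ! (i - 1))" "par (ws ! (i - 1)) = Some (ws ! (i - 2))"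
        using step[of i] step[of "i - 1"] i4 Suc ws by (auto simp: numeral_2_eq_2)
      then have "ws ! (i - 2) < ws ! (i - 1)" using head iu by auto
      moreover have "ws ! (i - 1) < ws ! (i - 2)"
      proof (cases "i = 4")
        case True
        then show ?thesis using lt[of 2 3] Suc ws by (auto simp: below_def)
      next
        case False
        then have "odd (i - 2 + (i - 1))" "even (i - 2)" "3 \<le> i - 2" "i - 2 < i - 1"
          using i4 \<open>even i\<close> by auto
        then show ?thesis using lt[of "i - 2" "i - 1"] Suc ws by (auto simp: below_def)
      qed
      ultimately show False by simp
    qed
  qed
  show ?thesis
  proof (cases "ws ! 1 \<in> P")
    case False
    have "down_path par' ws" unfolding down_path_def
    proof (intro allI impI)
      fix i assume i: "i + 1 < length ws"
      have "ws ! (i + 1) \<notin> P" using far[of "i + 1"] False i ws by (cases "i = 0") auto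
      then show "par' (ws ! (i + 1)) = Some (ws ! i)" using same step[of "i + 1"] i by auto
    qed
    then show ?thesis using ws by blast
  next
    case True
    from altD[OF True] step[of 1] have "ws ! 0 = u \<and> ws ! 1 < u \<or> ws ! 0 \<in> P \<and> (ws ! 1 < u \<longleftrightarrow> u < ws ! 0)"
      using ws by auto
    then have "\<not> ws ! 1 < u" using lt1 by auto
    moreover have "ws ! 1 \<noteq> u" using True uP by auto
    ultimately have u1: "u < ws ! 1" by simp
    \<comment> \<open>A vertex of \<open>P\<close> above \<open>u\<close> has its parent at or below
      \<open>u\<close>, also in the new forest.\<close>
    obtain y where y: "par' (ws ! 1) = Some y" "y < ws ! 1"
      using alt' True u1 unfolding alternating_def
      by (metis less_asym linorder_neqE_nat order.strict_trans)
    let ?ws = "ws[0 := y]"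
    have n: "?ws ! i = (if i = 0 then y else ws ! i)" if "i < k" for i using that ws by auto
    have "down_path par' ?ws" unfolding down_path_def
    proof (intro allI impI)
      fix i assume i: "i + 1 < length ?ws"
      show "par' (?ws ! (i + 1)) = Some (?ws ! i)"
      proof (cases "i = 0")
        case True then show ?thesis using y ws by auto
      next
        case False
        then have "ws ! (i + 1) \<notin> P" using far[of "i + 1"] i ws by auto
        then show ?thesis using same step[of "i + 1"] i False by auto
      qed
    qed
    moreover have "shape e ?ws" unfolding shape_def
    proof (intro allI impI)
      fix a b assume ab: "a < b" "b < length ?ws"
      show "if below e a b then ?ws ! a < ?ws ! b else ?ws ! b < ?ws ! a"
      proof (cases "a = 0")
        case True
        \<comment> \<open>The first vertex only has to lie below all others, and the second is the
          least of these.\<close>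
        have "ws ! 1 \<le> ws ! b" using lt[of 1 b] ab True by (cases "b = 1") (auto simp: below_def)
        moreover have "?ws ! 0 = y" using n[of 0] ws by simp
        ultimately show ?thesis using True y ab by (auto simp: below_def)
      next
        case False
        then show ?thesis using lt[of a b] ab by auto
      qed
    qed
    ultimately show ?thesis using ws by (intro exI[of _ ?ws]) auto
  qed
qed

section \<open>The twisted parent map is again a forest\<close>

abbreviation edges :: "(nat \<Rightarrow> nat option) \<Rightarrow> (nat \<times> nat) set" where
  "edges par \<equiv> {(v, w). par v = Some w}"

lemma down_path_trancl:
  assumes "down_path par vs" "a < b" "b < length vs"
  shows "(vs ! b, vs ! a) \<in> (edges par)\<^sup>+"
  using assms(2,3)
proof (induction b)
  case (Suc b)
  have e: "(vs ! Suc b, vs ! b) \<in> edges par" using down_path_step[OF assms(1), of "Suc b"] Suc by auto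
  show ?case
  proof (cases "a = b")
    case True then show ?thesis using e by auto
  next
    case False
    then have "(vs ! b, vs ! a) \<in> (edges par)\<^sup>+" using Suc by auto
    then show ?thesis using e by (meson trancl_into_trancl2)
  qed
qed simp

text \<open>It suffices that climbing always terminates. The path above \<open>u\<close> avoids
  \<open>P\<close> and is unchanged; from \<open>P\<close> one reaches \<open>u\<close> in the new
  forest; from any other vertex one climbs as in the old forest until \<open>P\<close> is met, if
  ever.\<close>

lemma acyclic_regraft:
  assumes ac: "acyclic (edges par)" and fin: "finite (edges par)"
    and same: "\<And>x. x \<notin> P \<Longrightarrow> par' x = par x"
    and P: "\<And>x. x \<in> P \<Longrightarrow> (x, u) \<in> (edges par)\<^sup>+" "\<And>x. x \<in> P \<Longrightarrow> (x, u) \<in> (edges par')\<^sup>+"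
  shows "acyclic (edges par')"
proof -
  let ?A = "Wellfounded.acc ((edges par')\<inverse>)"
  have wf: "wf ((edges par)\<inverse>)" using ac fin by (rule finite_acyclic_wf_converse[rotated])
  have acc_step: "v \<in> ?A" if "\<And>w. par' v = Some w \<Longrightarrow> w \<in> ?A" for v
    by (rule accI) (use that in auto)
  have "v \<in> ?A" if "(u, v) \<in> (edges par)\<^sup>*" for v
    using wf that
  proof (induction v rule: wf_induct_rule)
    case (less v)
    \<comment> \<open>An ancestor of \<open>u\<close> in \<open>P\<close> would have
      \<open>u\<close> as an ancestor, closing a cycle.\<close>
    have "v \<notin> P" using P(1)[of v] less.prems ac unfolding acyclic_def by (meson trancl_rtrancl_trancl)
    then show ?case using less same by (intro acc_step[of v]) (auto intro: rtrancl_into_rtrancl)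
  qed
  then have u: "u \<in> ?A" by blast
  have PA: "x \<in> ?A" if "x \<in> P" for x
    using P(2)[OF that]
  proof (induction rule: converse_trancl_induct)
    case (base y) then show ?case using u by (intro acc_step[of y]) auto
  next
    case (step y z) then show ?case by (intro acc_step[of y]) auto
  qed
  have "v \<in> ?A" for v
    using wf
  proof (induction v rule: wf_induct_rule)
    case (less v)
    show ?case
    proof (cases "v \<in> P")
      case False
      then show ?thesis using less same by (intro acc_step[of v]) auto
    qed (rule PA)
  qed
  then have "wf ((edges par')\<inverse>)" unfolding wf_iff_acc by blast
  then show ?thesis using wf_acyclic acyclic_converse by blast
qed

lemma rooted_forestD:
  assumes "rooted_forest n par"
  shows "par v = Some w \<Longrightarrow> v \<in> {1..n}" "par v = Some w \<Longrightarrow> w \<in> {1..n}" "acyclic (edges par)"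
  using assms unfolding rooted_forest_def by (metis option.distinct(1), blast, blast)

lemma rooted_forest_twist:
  assumes f: "rooted_forest n par" and m: "marked k u e par S" and k: "5 \<le> k" and j: "3 \<le> j"
  shows "rooted_forest n (twist j S par)"
proof -
  note fD = rooted_forestD[OF f]
  have T: "x \<in> {1..n}" if "x \<in> tails S" for x
    using alternating_tails[OF m k] that fD unfolding alternating_def by blast
  have "acyclic (edges (twist j S par))"
  proof (rule acyclic_regraft)
    show "acyclic (edges par)" by fact
    have "edges par \<subseteq> {1..n} \<times> {1..n}" using fD(1,2) by fast
    then show "finite (edges par)" using finite_subset by blast
    show "twist j S par x = par x" if "x \<notin> tails S" for x using that by (simp add: twist_def)
    have tr: "(x, u) \<in> (edges q)\<^sup>+" if "marked k u d q R" "x \<in> tails R" for x q R d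
    proof -
      note h = that
      obtain vs i where "vs \<in> R" "3 \<le> i" "i < length vs" "x = vs ! i" using h(2) unfolding tails_def by auto
      then show ?thesis using h(1) down_path_trancl[of q vs 2 i] unfolding marked_def by auto
    qed
    show "(x, u) \<in> (edges par)\<^sup>+" if "x \<in> tails S" for x using tr[OF m that] .
    show "(x, u) \<in> (edges (twist j S par))\<^sup>+" if "x \<in> tails S" for x
      using tr[OF marked_twist[OF m k j]] that tails_twist[OF m k j] by auto
  qed
  moreover have "twist j S par v = None" if "v \<notin> {1..n}" for v
    using that T fD(1)[of v] by (cases "par v") (auto simp: twist_def)
  moreover have "w \<in> {1..n}" if tw: "twist j S par v = Some w" for v w
  proof (cases "v \<in> tails S")
    case False then show ?thesis using that fD(2) by (simp add: twist_def)
  next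
    case True
    then obtain y where y: "par (swap j S v) = Some y" "w = swap j S y" using tw by (auto simp: twist_def)
    then show ?thesis using fD(2)[of _ y] T swap_tails[OF m k j, of y] swap_fixed[OF m k j, of y]
        block_outside[OF m k j, of y] by (cases "y \<in> tails S") auto
  qed
  ultimately show ?thesis unfolding rooted_forest_def by blast
qed

section \<open>Inclusion-exclusion over sets of occurrences\<close>

definition occurrences :: "nat \<Rightarrow> nat \<Rightarrow> (nat \<Rightarrow> bool) \<Rightarrow> (nat \<Rightarrow> nat option) \<Rightarrow> nat list set" where
  "occurrences k u e par = {vs. length vs = k \<and> down_path par vs \<and> vs ! 2 = u \<and> shape e vs}"

text \<open>Third vertices in \<open>U\<close> are left unconstrained; a singleton \<open>U\<close>
  isolates the vertex whose choice of bits is being changed.\<close>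

definition avoiding_except :: "nat set \<Rightarrow> nat \<Rightarrow> nat \<Rightarrow> (nat \<Rightarrow> nat \<Rightarrow> bool) \<Rightarrow> (nat \<Rightarrow> nat option) set" where
  "avoiding_except U n k \<Phi> = {par. rooted_forest n par \<and> (\<forall>u. u \<notin> U \<longrightarrow> occurrences k u (\<Phi> u) par = {})}"

lemma finite_rooted_forests: "finite {par. rooted_forest n par}"
proof (rule finite_subset)
  show "finite {f. \<forall>x. (x \<in> {1..n} \<longrightarrow> f x \<in> insert None (Some ` {1..n})) \<and> (x \<notin> {1..n} \<longrightarrow> f x = None)}"
    by (rule finite_set_of_finite_funs) auto
  show "{par. rooted_forest n par} \<subseteq> {f. \<forall>x. (x \<in> {1..n} \<longrightarrow> f x \<in> insert None (Some ` {1..n})) \<and> (x \<notin> {1..n} \<longrightarrow> f x = None)}"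
  proof (intro subsetI CollectI allI conjI impI)
    fix f x assume f: "f \<in> {par. rooted_forest n par}"
    show "f x \<in> insert None (Some ` {1..n})"
      using rooted_forestD(2)[of n f x] f by (cases "f x") auto
    show "f x = None" if "x \<notin> {1..n}" using f that unfolding rooted_forest_def by blast
  qed
qed

lemma finite_avoiding_except: "finite (avoiding_except U n k \<Phi>)"
  by (rule finite_subset[OF _ finite_rooted_forests[of n]]) (auto simp: avoiding_except_def)

lemma down_path_in_range:
  assumes "rooted_forest n par" "down_path par vs" "2 \<le> length vs" "i < length vs"
  shows "vs ! i \<in> {1..n}"
proof (cases "i = 0")
  case True
  then show ?thesis using down_path_step[OF assms(2), of 1] rooted_forestD(2)[OF assms(1)] assms by auto
next
  case False
  then show ?thesis using down_path_step[OF assms(2), of i] rooted_forestD(1)[OF assms(1)] assms by auto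
qed

lemma finite_occurrences:
  assumes "rooted_forest n par" "2 \<le> k"
  shows "finite (occurrences k u e par)"
proof (rule finite_subset)
  show "finite {vs. set vs \<subseteq> {1..n} \<and> length vs = k}" by (rule finite_lists_length_eq) simp
  show "occurrences k u e par \<subseteq> {vs. set vs \<subseteq> {1..n} \<and> length vs = k}"
    unfolding occurrences_def using down_path_in_range[OF assms(1)] assms(2)
    by (fastforce simp: in_set_conv_nth)
qed

lemma marked_iff:
  assumes "rooted_forest n par" "2 \<le> k"
  shows "S \<subseteq> occurrences k u e par \<longleftrightarrow> marked k u e par S"
proof
  assume "S \<subseteq> occurrences k u e par"
  moreover from this have "finite S" using finite_occurrences[OF assms] finite_subset by blast
  ultimately show "marked k u e par S" by (auto simp: marked_def occurrences_def)
qed (auto simp: marked_def occurrences_def)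

text \<open>The transfer is applied backwards: an occurrence with third vertex
  \<open>v \<noteq> u\<close> in the twisted forest would produce one in \<open>par\<close>.\<close>

lemma twist_avoiding_except:
  assumes B: "par \<in> avoiding_except {u} n k \<Phi>" and m: "marked k u e par S" and k: "5 \<le> k" and j: "3 \<le> j"
  shows "twist j S par \<in> avoiding_except {u} n k \<Phi>"
proof -
  have f: "rooted_forest n par" using B by (auto simp: avoiding_except_def)
  have "occurrences k v (\<Phi> v) (twist j S par) = {}" if v: "v \<noteq> u" for v
  proof (rule ccontr)
    assume "occurrences k v (\<Phi> v) (twist j S par) \<noteq> {}"
    then obtain ws where ws: "length ws = k" "down_path (twist j S par) ws" "ws ! 2 = v" "shape (\<Phi> v) ws"
      unfolding occurrences_def by auto
    have "\<exists>ws. length ws = k \<and> down_path par ws \<and> shape (\<Phi> v) ws \<and> ws ! 2 = v"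
    \<comment> \<open>The two ascents ending at \<open>u\<close> come from a marked occurrence;
      without one, \<open>twist\<close> is the identity.\<close>
    proof (cases "S = {}")
      case True
      then have "twist j S par = par" by (auto simp: twist_def tails_def)
      then show ?thesis using ws by auto
    next
      case False
      note m' = marked_twist[OF m k j]
      obtain p q where "twist j S par u = Some p" "twist j S par p = Some q" "q < p" "p < u"
        using marked_head[OF m' k] False by auto
      then show ?thesis
        using transfer_occurrence[OF alternating_tails[OF m' k, unfolded tails_twist[OF m k j]]
            alternating_tails[OF m k] _ _ _ _ _ ws(1) k ws(2,4)] ws(3) v
        by (auto simp: twist_def)
    qed
    then show False using B v by (auto simp: avoiding_except_def occurrences_def)
  qed
  then show ?thesis using rooted_forest_twist[OF f m k j] by (auto simp: avoiding_except_def)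
qed

lemma alternating_sum_Pow:
  assumes "finite A"
  shows "(\<Sum>S\<in>Pow A. (-1) ^ card S) = (if A = {} then 1 else (0 :: int))"
proof -
  have "(\<Sum>S\<in>Pow A. (-1) ^ card S) = (\<Prod>x\<in>A. 1 - 1 :: int)"
    unfolding prod_diff_conv_sum[OF assms] by simp
  then show ?thesis using assms by (simp add: power_0_left)
qed

text \<open>Inclusion-exclusion: the signed sum over the subsets of \<open>A x\<close> vanishes
  unless \<open>A x\<close> is empty.\<close>

lemma card_empty_fibre:
  assumes "finite B" "\<And>x. x \<in> B \<Longrightarrow> finite (A x)"
  shows "int (card {x \<in> B. A x = {}}) = (\<Sum>(x, S)\<in>Sigma B (\<lambda>x. Pow (A x)). (-1) ^ card S)"
proof -
  have "(\<Sum>(x, S)\<in>Sigma B (\<lambda>x. Pow (A x)). (-1) ^ card S) = (\<Sum>x\<in>B. \<Sum>S\<in>Pow (A x). (-1) ^ card S :: int)"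
    using assms by (subst sum.Sigma) auto
  also have "\<dots> = (\<Sum>x\<in>B. if A x = {} then 1 else 0)"
    using assms by (intro sum.cong refl alternating_sum_Pow) auto
  also have "\<dots> = int (card {x \<in> B. A x = {}})"
    using assms(1) by (simp add: sum.If_cases Int_def)
  finally show ?thesis by simp
qed

lemma twist_maps_to:
  assumes "par \<in> avoiding_except {u} n k \<Phi>" "S \<subseteq> occurrences k u e par" and k: "5 \<le> k" and j: "3 \<le> j"
  shows "twist j S par \<in> avoiding_except {u} n k \<Phi>"
    and "map (swap j S) ` S \<subseteq> occurrences k u (flip j e) (twist j S par)"
    and "card (map (swap j S) ` S) = card S"
    and "twist j (map (swap j S) ` S) (twist j S par) = par"
    and "map (swap j (map (swap j S) ` S)) ` map (swap j S) ` S = S"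
proof -
  have f: "rooted_forest n par" using assms by (auto simp: avoiding_except_def)
  have m: "marked k u e par S" using assms marked_iff[OF f, of k] by auto
  show 1: "twist j S par \<in> avoiding_except {u} n k \<Phi>"
    using twist_avoiding_except[OF assms(1) m k j] .
  show "map (swap j S) ` S \<subseteq> occurrences k u (flip j e) (twist j S par)"
    using marked_twist[OF m k j] by (auto simp: marked_def occurrences_def)
  show "card (map (swap j S) ` S) = card S"
    by (rule card_image) (auto intro!: inj_onI dest: map_injective simp: inj_def swap_eq_iff[OF m k j])
  show "twist j (map (swap j S) ` S) (twist j S par) = par"
    "map (swap j (map (swap j S) ` S)) ` map (swap j S) ` S = S"
    using twist_twist[OF m k j] map_swap_twist[OF m k j] by auto
qed

text \<open>Both counts are signed sums over pairs of a forest and a set of marked occurrences.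
  Twisting is a bijection between the pairs for \<open>e\<close> and those for
  \<open>flip j e\<close>, and it keeps the number of marks and hence the sign.\<close>

lemma card_avoiding_flip:
  assumes k: "5 \<le> k" and j: "3 \<le> j"
  shows "card {par \<in> avoiding_except {u} n k \<Phi>. occurrences k u (flip j e) par = {}} =
         card {par \<in> avoiding_except {u} n k \<Phi>. occurrences k u e par = {}}"
proof -
  let ?B = "avoiding_except {u} n k \<Phi>"
  let ?D = "\<lambda>e. Sigma ?B (\<lambda>par. Pow (occurrences k u e par))"
  let ?f = "\<lambda>(par, S). (twist j S par, map (swap j S) ` S)"
  note T = twist_maps_to[where u = u and n = n and k = k and \<Phi> = \<Phi>, OF _ _ k j]
  have fin: "finite (occurrences k u e par)" if "par \<in> ?B" for par e
    using that k by (intro finite_occurrences[of n]) (auto simp: avoiding_except_def)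
  have fibre: "int (card {par \<in> ?B. occurrences k u e par = {}}) = (\<Sum>(x, S)\<in>?D e. (-1) ^ card S)" for e
    by (rule card_empty_fibre[OF finite_avoiding_except fin])
  have maps: "?f ` ?D e \<subseteq> ?D (flip j e)" for e
  proof
    fix y assume "y \<in> ?f ` ?D e"
    then obtain par S where "par \<in> ?B" "S \<subseteq> occurrences k u e par" "y = (twist j S par, map (swap j S) ` S)"
      by auto
    then show "y \<in> ?D (flip j e)" using T(1,2)[of par S e] by simp
  qed
  have "bij_betw ?f (?D e) (?D (flip j e))"
  proof (rule bij_betw_byWitness[of _ ?f])
    show "?f ` ?D e \<subseteq> ?D (flip j e)" by (rule maps)
    show "?f ` ?D (flip j e) \<subseteq> ?D e" using maps[of "flip j e"] by simp
  next
    show "\<forall>a\<in>?D e. ?f (?f a) = a" using T(4,5) by (simp add: split_paired_all)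
    show "\<forall>a\<in>?D (flip j e). ?f (?f a) = a" using T(4,5) by (simp add: split_paired_all)
  qed
  then have "(\<Sum>(x, S)\<in>?D (flip j e). (-1) ^ card S) = (\<Sum>p\<in>?D e. (case ?f p of (x, S) \<Rightarrow> (-1) ^ card S) :: int)"
    by (rule sum.reindex_bij_betw[symmetric])
  also have "\<dots> = (\<Sum>(x, S)\<in>?D e. (-1) ^ card S)"
  proof (rule sum.cong[OF refl])
    fix p assume "p \<in> ?D e"
    then obtain par S where "par \<in> ?B" "S \<subseteq> occurrences k u e par" "p = (par, S)" by auto
    then show "(case ?f p of (x, S) \<Rightarrow> (-1) ^ card S) = ((case p of (x, S) \<Rightarrow> (-1) ^ card S) :: int)"
      using T(3)[of par S e] by simp
  qed
  finally have "int (card {par \<in> ?B. occurrences k u (flip j e) par = {}}) = int (card {par \<in> ?B. occurrences k u e par = {}})"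
    unfolding fibre .
  then show ?thesis by simp
qed

section \<open>Independence of the count from the choice of bits\<close>

definition avoiding :: "nat \<Rightarrow> nat \<Rightarrow> (nat \<Rightarrow> nat \<Rightarrow> bool) \<Rightarrow> (nat \<Rightarrow> nat option) set" where
  "avoiding n k \<Phi> = avoiding_except {} n k \<Phi>"

lemma card_avoiding_upd:
  assumes k: "5 \<le> k" and j: "3 \<le> j"
  shows "card (avoiding n k (\<Phi>(u := flip j (\<Phi> u)))) = card (avoiding n k \<Phi>)"
proof -
  have "avoiding n k (\<Phi>(u := e)) = {par \<in> avoiding_except {u} n k \<Phi>. occurrences k u e par = {}}" for e
    unfolding avoiding_def avoiding_except_def by (auto split: if_splits)
  from this[of "flip j (\<Phi> u)"] this[of "\<Phi> u"] show ?thesis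
    using card_avoiding_flip[OF k j, where u = u and n = n and \<Phi> = \<Phi> and e = "\<Phi> u"] by simp
qed

text \<open>A third vertex lies in \<open>{1..n}\<close>, so flipping the choice at these finitely
  many labels, one at a time, has the effect of flipping it everywhere.\<close>

lemma card_avoiding_const_flip:
  assumes k: "5 \<le> k" and j: "3 \<le> j"
  shows "card (avoiding n k (\<lambda>_. flip j e)) = card (avoiding n k (\<lambda>_. e))"
proof -
  have *: "card (avoiding n k (\<lambda>u. if u \<in> A then flip j e else e)) = card (avoiding n k (\<lambda>_. e))" if "finite A" for A
    using that
  proof (induction A)
    case (insert a A)
    let ?\<Phi> = "\<lambda>u. if u \<in> A then flip j e else e"
    have "(\<lambda>u. if u \<in> insert a A then flip j e else e) = ?\<Phi>(a := flip j (?\<Phi> a))"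
      using insert.hyps by auto
    then show ?case using card_avoiding_upd[OF k j, where \<Phi> = ?\<Phi> and u = a and n = n] insert by simp
  qed simp
  have "avoiding n k (\<lambda>_. flip j e) = avoiding n k (\<lambda>u. if u \<in> {1..n} then flip j e else e)"
  proof -
    have "occurrences k u d par = {}" if "rooted_forest n par" "u \<notin> {1..n}" for u d par
    proof -
      have "vs ! 2 \<in> {1..n}" if "length vs = k" "down_path par vs" for vs
        using down_path_in_range[OF \<open>rooted_forest n par\<close> that(2)] that(1) k by simp
      then show ?thesis using that(2) unfolding occurrences_def by blast
    qed
    then have "(\<forall>u. occurrences k u (flip j e) par = {}) \<longleftrightarrow>
        (\<forall>u. occurrences k u (if u \<in> {1..n} then flip j e else e) par = {})"
      if "rooted_forest n par" for par using that by (metis (full_types))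
    then show ?thesis
      by (simp only: avoiding_def avoiding_except_def empty_iff not_False_eq_True simp_thms cong: conj_cong)
  qed
  then show ?thesis using *[of "{1..n}"] by simp
qed

lemma card_avoiding_const_upd:
  assumes k: "5 \<le> k" and j: "3 \<le> j"
  shows "card (avoiding n k (\<lambda>_. e(j := \<not> e j))) = card (avoiding n k (\<lambda>_. e))"
proof -
  \<comment> \<open>The negations at \<open>j + 2, j + 4, ...\<close> cancel, leaving the one at
    \<open>j\<close>.\<close>
  have eq: "e(j := \<not> e j) = flip j (flip (j + 2) e)"
  proof
    fix i show "(e(j := \<not> e j)) i = flip j (flip (j + 2) e) i"
    proof -
      consider "i < j" | "i = j" | "i = j + 1" | "j + 2 \<le> i" by linarith
      then show ?thesis by cases (auto simp: flip_def)
    qed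
  qed
  have j2: "3 \<le> j + 2" using j by simp
  show ?thesis unfolding eq
    using card_avoiding_const_flip[OF k j, where n = n and e = "flip (j + 2) e"]
      card_avoiding_const_flip[OF k j2, where n = n and e = e] by (rule trans)
qed

lemma card_avoiding_set:
  assumes k: "5 \<le> k" and "finite D" "D \<subseteq> {3..}"
  shows "card (avoiding n k (\<lambda>_ i. i \<in> D)) = card (avoiding n k (\<lambda>_ _. False))"
  using assms(2,3)
proof (induction D)
  case (insert j D)
  have eq: "(\<lambda>i. i \<in> insert j D) = (\<lambda>i. i \<in> D)(j := \<not> j \<in> D)"
    by (rule ext) (use insert.hyps(2) in simp)
  have j: "3 \<le> j" and D: "D \<subseteq> {3..}" using insert.prems by auto
  show ?case unfolding eq
    using card_avoiding_const_upd[OF k j, where n = n and e = "\<lambda>i. i \<in> D"] insert.IH[OF D] by (rule trans)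
qed simp

section \<open>Patterns of a given shape\<close>

lemma consec_instance_iff:
  assumes e: "shape e pat" and k: "length pat = k"
  shows "consec_instance par pat vs \<longleftrightarrow> length vs = k \<and> down_path par vs \<and> shape e vs"
proof -
  have pat: "if below e i j then pat ! i < pat ! j else pat ! j < pat ! i" if "i < j" "j < k" for i j
    using e that k unfolding shape_def by blast
  have "(\<forall>i<k. \<forall>j<k. vs ! i < vs ! j \<longleftrightarrow> pat ! i < pat ! j) \<longleftrightarrow> shape e vs" if l: "length vs = k"
  proof
    assume "\<forall>i<k. \<forall>j<k. vs ! i < vs ! j \<longleftrightarrow> pat ! i < pat ! j"
    then show "shape e vs" unfolding shape_def l using pat by (metis less_trans)
  next
    assume s: "shape e vs"
    have vs: "if below e i j then vs ! i < vs ! j else vs ! j < vs ! i" if "i < j" "j < k" for i j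
      using s that l unfolding shape_def by blast
    show "\<forall>i<k. \<forall>j<k. vs ! i < vs ! j \<longleftrightarrow> pat ! i < pat ! j"
    proof (intro allI impI)
      fix i j assume ij: "i < k" "j < k"
      consider "i < j" | "i = j" | "j < i" by linarith
      then show "vs ! i < vs ! j \<longleftrightarrow> pat ! i < pat ! j"
      proof cases
        case 1
        then show ?thesis using pat[of i j] vs[of i j] ij by (cases "below e i j") auto
      next
        case 3
        then show ?thesis using pat[of j i] vs[of j i] ij by (cases "below e j i") auto
      qed simp
    qed
  qed
  then show ?thesis unfolding consec_instance_def down_path_def k by blast
qed

lemma num_avoiding_eq_card_avoiding:
  assumes "shape e pat" "is_pattern k pat"
  shows "num_avoiding n pat = card (avoiding n k (\<lambda>_. e))"
proof -
  have "length pat = k" using assms(2) by (simp add: is_pattern_def)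
  then have "consec_avoids par pat \<longleftrightarrow> (\<forall>u. occurrences k u e par = {})" for par
    unfolding consec_avoids_def occurrences_def using consec_instance_iff[OF assms(1)] by auto
  then show ?thesis unfolding num_avoiding_def avoiding_def avoiding_except_def by simp
qed

text \<open>Each value is replaced by its rank; counting \<open>f j \<le> f i\<close> includes
  \<open>i\<close> itself, so ranks start at 1.\<close>

lemma standardization:
  fixes f :: "nat \<Rightarrow> int"
  assumes inj: "inj_on f {..<k}"
  shows "\<exists>p. is_pattern k p \<and> (\<forall>i<k. \<forall>j<k. p ! i < p ! j \<longleftrightarrow> f i < f j)"
proof -
  define r where "r i = card {j \<in> {..<k}. f j \<le> f i}" for i
  have r_less: "r i < r j" if "i < k" "j < k" "f i < f j" for i j
    unfolding r_def
  proof (rule psubset_card_mono)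
    have "j \<in> {l \<in> {..<k}. f l \<le> f j}" "j \<notin> {l \<in> {..<k}. f l \<le> f i}" using that by auto
    moreover have "{l \<in> {..<k}. f l \<le> f i} \<subseteq> {l \<in> {..<k}. f l \<le> f j}" using that by auto
    ultimately show "{l \<in> {..<k}. f l \<le> f i} \<subset> {l \<in> {..<k}. f l \<le> f j}" by blast
  qed simp
  have r_less_iff: "r i < r j \<longleftrightarrow> f i < f j" if "i < k" "j < k" for i j
    using r_less[of i j] r_less[of j i] that inj
    by (metis inj_on_eq_iff lessThan_iff linorder_neqE less_asym less_irrefl)
  have rinj: "inj_on r {..<k}"
  proof (rule inj_onI)
    fix i j assume ij: "i \<in> {..<k}" "j \<in> {..<k}" "r i = r j"
    then have "f i = f j" using r_less[of i j] r_less[of j i] by (metis lessThan_iff linorder_neqE less_irrefl)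
    then show "i = j" using inj ij by (simp add: inj_on_eq_iff)
  qed
  have "r i \<in> {1..k}" if "i < k" for i
  proof -
    have "card {i} \<le> r i" unfolding r_def by (rule card_mono) (use that in auto)
    moreover have "r i \<le> card {..<k}" unfolding r_def by (rule card_mono) auto
    ultimately show ?thesis by simp
  qed
  then have "r ` {..<k} = {1..k}"
    using card_image[OF rinj] by (intro card_subset_eq) auto
  then have "is_pattern k (map r [0..<k])"
    unfolding is_pattern_def using rinj by (simp add: distinct_map lessThan_atLeast0)
  then show ?thesis using r_less_iff by (intro exI[of _ "map r [0..<k]"]) auto
qed

lemma ex_pattern_of_shape: "\<exists>p. is_pattern k p \<and> shape e p"
proof -
  \<comment> \<open>The absolute values \<open>k - i\<close> decrease, so the sign chosen by
    \<open>e i\<close> puts \<open>s i\<close> below or above all later values.\<close>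
  define s where "s i = (if e i then int i - int k else int k - int i)" for i
  \<comment> \<open>Shifts by \<open>2 * k\<close> in opposite directions put low letters below 0
    and high ones above; \<open>- 5 * k\<close> puts the first two below everything else.\<close>
  define h where "h i = (if i < 2 then int i - 5 * int k else if i = 2 then 0
     else if odd i then s i - 2 * int k else s i + 2 * int k)" for i
  have s: "\<bar>s i\<bar> = int k - int i" if "i < k" for i using that by (auto simp: s_def)
  have h: "if below e i j then h i < h j else h j < h i" if "i < j" "j < k" for i j
  proof -
    have si: "\<bar>s i\<bar> = int k - int i" and sj: "\<bar>s j\<bar> = int k - int j" using s that by auto
    consider "i < 2" "j < 2" | "i < 2" "2 \<le> j" | "i = 2" | "3 \<le> i" "even (i + j)" | "3 \<le> i" "odd (i + j)"
      by linarith
    then show ?thesis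
    proof cases
      case 1
      then show ?thesis using that by (simp add: below_def h_def)
    next
      case 2
      then have "int i - 5 * int k < h j" using sj that by (auto simp: h_def)
      then show ?thesis using 2 by (simp add: below_def h_def)
    next
      case 3
      then show ?thesis using sj that by (auto simp: below_def h_def)
    next
      case 4
      have "if e i then s i < s j else s j < s i" using sj that by (auto simp: s_def)
      then show ?thesis using 4 that by (auto simp: below_def h_def)
    next
      case 5
      then show ?thesis using si sj that by (auto simp: below_def h_def)
    qed
  qed
  have "h i \<noteq> h j" if "i < j" "j < k" for i j using h[OF that] by (auto split: if_splits)
  then have "inj_on h {..<k}" by (intro inj_onI) (metis lessThan_iff linorder_neqE_nat)
  then obtain p where p: "is_pattern k p" "\<forall>i<k. \<forall>j<k. p ! i < p ! j \<longleftrightarrow> h i < h j"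
    using standardization by blast
  have "length p = k" using p(1) by (simp add: is_pattern_def)
  then have "shape e p" unfolding shape_def using h p(2) by (metis less_trans)
  then show ?thesis using p(1) by blast
qed

section \<open>Complementation\<close>

text \<open>The identity outside \<open>{1..n}\<close> makes this an involution on all of
  \<open>nat\<close>.\<close>

definition reflect :: "nat \<Rightarrow> nat \<Rightarrow> nat" where
  "reflect n x = (if x \<in> {1..n} then n + 1 - x else x)"

lemma reflect_reflect [simp]: "reflect n (reflect n x) = x"
  by (auto simp: reflect_def)

lemma reflect_in_iff [simp]: "reflect n x \<in> {1..n} \<longleftrightarrow> x \<in> {1..n}"
  by (auto simp: reflect_def)

lemma reflect_less_iff: "x \<in> {1..n} \<Longrightarrow> y \<in> {1..n} \<Longrightarrow> reflect n x < reflect n y \<longleftrightarrow> y < x"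
  by (auto simp: reflect_def)

definition reflect_forest :: "nat \<Rightarrow> (nat \<Rightarrow> nat option) \<Rightarrow> nat \<Rightarrow> nat option" where
  "reflect_forest n par x = map_option (reflect n) (par (reflect n x))"

lemma reflect_forest_reflect_forest [simp]: "reflect_forest n (reflect_forest n par) = par"
  by (rule ext) (simp add: reflect_forest_def option.map_comp o_def option.map_ident)

lemma reflect_forest_eq_Some_iff:
  "reflect_forest n par x = Some y \<longleftrightarrow> par (reflect n x) = Some (reflect n y)"
  unfolding reflect_forest_def by (metis (no_types, lifting) map_option_eq_Some reflect_reflect)

lemma rooted_forest_reflect:
  assumes "rooted_forest n par"
  shows "rooted_forest n (reflect_forest n par)"
proof -
  note D = rooted_forestD[OF assms]
  have "(reflect n x, reflect n y) \<in> (edges par)\<^sup>+" if "(x, y) \<in> (edges (reflect_forest n par))\<^sup>+" for x y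
    using that
  proof (induction rule: trancl_induct)
    case (base y)
    then show ?case by (auto simp: reflect_forest_eq_Some_iff)
  next
    case (step y z)
    then have "(reflect n y, reflect n z) \<in> edges par" by (auto simp: reflect_forest_eq_Some_iff)
    with step.IH show ?case by (rule trancl_into_trancl)
  qed
  then have "acyclic (edges (reflect_forest n par))" using D(3) unfolding acyclic_def by blast
  moreover have "reflect_forest n par v = None" if "v \<notin> {1..n}" for v
    using D(1)[of "reflect n v"] that reflect_in_iff[of n v]
    by (cases "par (reflect n v)") (auto simp: reflect_forest_def)
  moreover have "u \<in> {1..n}" if "reflect_forest n par v = Some u" for u v
    using D(2)[of "reflect n v" "reflect n u"] that by (simp only: reflect_forest_eq_Some_iff reflect_in_iff)
  ultimately show ?thesis unfolding rooted_forest_def by blast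
qed

text \<open>With \<open>2 \<le> k\<close> each vertex of the path is on an edge, hence in
  \<open>{1..n}\<close>, where reflection reverses the order just as it does for the letters of the
  pattern.\<close>

lemma consec_instance_reflect:
  assumes f: "rooted_forest n par" and p: "is_pattern k p" "2 \<le> k" and i: "consec_instance par p vs"
  shows "consec_instance (reflect_forest n par) (map (reflect k) p) (map (reflect n) vs)"
proof -
  have l: "length vs = k" "length p = k" and path: "down_path par vs"
    and ord: "\<And>i j. i < k \<Longrightarrow> j < k \<Longrightarrow> vs ! i < vs ! j \<longleftrightarrow> p ! i < p ! j"
    using p i unfolding consec_instance_def is_pattern_def down_path_def by auto
  have vs: "vs ! a \<in> {1..n}" if "a < k" for a using down_path_in_range[OF f path] l p that by simp
  have pk: "p ! a \<in> {1..k}" if "a < k" for a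
    using p(1) nth_mem[of a p] that l unfolding is_pattern_def by auto
  show ?thesis unfolding consec_instance_def
  proof (intro conjI allI impI)
    fix a assume "a + 1 < length (map (reflect n) vs)"
    then show "reflect_forest n par (map (reflect n) vs ! (a + 1)) = Some (map (reflect n) vs ! a)"
      using path unfolding down_path_def by (simp add: reflect_forest_eq_Some_iff)
  next
    fix a b assume "a < length (map (reflect n) vs)" "b < length (map (reflect n) vs)"
    then show "map (reflect n) vs ! a < map (reflect n) vs ! b \<longleftrightarrow> map (reflect k) p ! a < map (reflect k) p ! b"
      using reflect_less_iff[OF vs vs, of a b] reflect_less_iff[OF pk pk, of a b] ord l by simp
  qed (use l in simp)
qed

lemma is_pattern_reflect:
  assumes "is_pattern k p"
  shows "is_pattern k (map (reflect k) p)"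
proof -
  have "inj_on (reflect k) A" for A by (rule inj_onI) (metis reflect_reflect)
  moreover have "reflect k ` {1..k} = {1..k}"
    using reflect_in_iff[of k] reflect_reflect[of k] by (metis image_eqI subset_antisym image_subsetI subsetI)
  ultimately show ?thesis using assms by (simp add: is_pattern_def distinct_map)
qed

lemma map_reflect_reflect: "map (reflect k) (map (reflect k) p) = p"
  by (simp add: o_def)

lemma num_avoiding_reflect:
  assumes p: "is_pattern k p" "2 \<le> k"
  shows "num_avoiding n (map (reflect k) p) = num_avoiding n p"
proof -
  let ?A = "\<lambda>p. {par. rooted_forest n par \<and> consec_avoids par p}"
  have *: "reflect_forest n par \<in> ?A (map (reflect k) p)" if p: "is_pattern k p" and par: "par \<in> ?A p" for par p
  proof -
    have f: "rooted_forest n (reflect_forest n par)" using par rooted_forest_reflect by blast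
    have "\<not> consec_instance (reflect_forest n par) (map (reflect k) p) vs" for vs
    proof
      assume "consec_instance (reflect_forest n par) (map (reflect k) p) vs"
      from consec_instance_reflect[OF f is_pattern_reflect[OF p] assms(2) this] par
      show False unfolding map_reflect_reflect reflect_forest_reflect_forest consec_avoids_def by blast
    qed
    then show ?thesis using f by (simp add: consec_avoids_def)
  qed
  have "bij_betw (reflect_forest n) (?A (map (reflect k) p)) (?A p)"
    using *[OF p(1)] *[OF is_pattern_reflect[OF p(1)], unfolded map_reflect_reflect]
    by (intro bij_betw_byWitness[of _ "reflect_forest n"]) auto
  then show ?thesis unfolding num_avoiding_def by (rule bij_betw_same_card)
qed

section \<open>The family of patterns and its size\<close>

definition alternating_pattern :: "nat \<Rightarrow> nat set \<Rightarrow> nat list" where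
  "alternating_pattern k D = (SOME p. is_pattern k p \<and> shape (\<lambda>i. i \<in> D) p)"

lemma alternating_pattern:
  "is_pattern k (alternating_pattern k D)" "shape (\<lambda>i. i \<in> D) (alternating_pattern k D)"
  using someI_ex[OF ex_pattern_of_shape[of k "\<lambda>i. i \<in> D"]] unfolding alternating_pattern_def by auto

text \<open>For \<open>i \<le> k - 3\<close> position \<open>i + 2\<close> still exists, and
  comparing the letters at \<open>i\<close> and \<open>i + 2\<close> recovers the bit at
  \<open>i\<close>.\<close>

lemma inj_alternating_pattern:
  assumes k: "5 \<le> k"
  shows "inj_on (alternating_pattern k) (Pow {3..k - 3})"
proof (rule inj_onI)
  fix C D assume CD: "C \<in> Pow {3..k - 3}" "D \<in> Pow {3..k - 3}"
    and eq: "alternating_pattern k C = alternating_pattern k D"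
  let ?p = "alternating_pattern k C"
  have l: "length ?p = k" using alternating_pattern(1)[of k C] by (simp add: is_pattern_def)
  have "i \<in> C \<longleftrightarrow> i \<in> D" for i
  proof (cases "i \<in> {3..k - 3}")
    case True
    then have i: "3 \<le> i" "i + 2 < k" using k by auto
    have "?p ! i < ?p ! (i + 2) \<longleftrightarrow> i \<in> E" if "shape (\<lambda>i. i \<in> E) ?p" for E
      using that[unfolded shape_def, rule_format, of i "i + 2"] i l
      by (auto simp: below_def split: if_splits)
    then show ?thesis using alternating_pattern(2)[of C k] alternating_pattern(2)[of D k] eq by metis
  qed (use CD in blast)
  then show "C = D" by blast
qed

theorem theorem1p5:
  fixes n :: nat
  assumes "n \<ge> 1"
  shows "\<exists>sigma. (\<exists>k. is_pattern k sigma) \<and>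
           2 powr (real n - 4) \<le> real (card {tau \<in> cfw_class sigma. is_pattern n tau})"
proof -
  let ?P = "alternating_pattern n"
  define T where "T = {tau \<in> cfw_class (?P {}). is_pattern n tau}"
  have "finite {tau. set tau \<subseteq> {1..n} \<and> length tau = n}" by (rule finite_lists_length_eq) simp
  then have fin: "finite T" by (rule rev_finite_subset) (auto simp: T_def is_pattern_def)
  have "2 powr (real n - 4) \<le> real (card T)"
  proof (cases "n < 5")
    case True
    \<comment> \<open>For these \<open>n\<close> the bound is at most 1, and the class contains its
      representative.\<close>
    have "?P {} \<in> T" using alternating_pattern(1) by (auto simp: T_def cfw_class_def c_forest_wilf_equiv_def)
    then have "1 \<le> card T" using fin by (metis One_nat_def Suc_leI card_gt_0_iff empty_iff)
    moreover have "2 powr (real n - 4) \<le> 2 powr 0" using True by (intro powr_mono) auto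
    ultimately show ?thesis by simp
  next
    case False
    then have n: "5 \<le> n" by simp
    let ?I = "Pow {3..n - 3}"
    let ?R = "map (reflect n)"
    have count: "num_avoiding m (?P D) = num_avoiding m (?P {})" if "D \<in> ?I" for D m
    proof -
      have "finite D" "D \<subseteq> {3..}" using that finite_subset by auto
      then show ?thesis using card_avoiding_set[OF n, of D m] 
          num_avoiding_eq_card_avoiding[OF alternating_pattern(2,1)]
        by simp
    qed
    have "?P D \<in> T" "?R (?P D) \<in> T" if "D \<in> ?I" for D
    proof -
      have "is_pattern n (?P D)" "is_pattern n (?R (?P D))"
        using alternating_pattern(1) is_pattern_reflect by blast+
      moreover have "num_avoiding m (?R (?P D)) = num_avoiding m (?P D)" for m
        using num_avoiding_reflect[OF alternating_pattern(1)] n by simp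
      ultimately show "?P D \<in> T" "?R (?P D) \<in> T"
        unfolding T_def cfw_class_def c_forest_wilf_equiv_def using count[OF that] by auto
    qed
    then have sub: "?P ` ?I \<union> (?R \<circ> ?P) ` ?I \<subseteq> T" by auto
    \<comment> \<open>Every pattern of the family starts with an ascent and every complement with a
      descent, so the two halves are disjoint.\<close>
    have asc: "?P D ! 0 < ?P D ! 1 \<and> \<not> ?R (?P D) ! 0 < ?R (?P D) ! 1" for D
    proof -
      have l: "length (?P D) = n" and s: "set (?P D) = {1..n}"
        using alternating_pattern(1)[of n D] by (auto simp: is_pattern_def)
      have "?P D ! 0 \<in> {1..n}" "?P D ! 1 \<in> {1..n}" using nth_mem[of _ "?P D"] l s n by auto
      moreover have "?P D ! 0 < ?P D ! 1"
        using alternating_pattern(2)[of D n, unfolded shape_def, rule_format, of 0 1] l n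
        by (simp add: below_def)
      ultimately show ?thesis using reflect_less_iff l n by simp
    qed
    have inj: "inj_on ?P ?I" "inj_on (?R \<circ> ?P) ?I"
    proof -
      show "inj_on ?P ?I" using inj_alternating_pattern[OF n] .
      moreover have "inj_on ?R (?P ` ?I)" by (rule inj_onI) (metis map_reflect_reflect)
      ultimately show "inj_on (?R \<circ> ?P) ?I" by (rule comp_inj_on)
    qed
    have "?P C \<noteq> ?R (?P D)" for C D using asc[of C] asc[of D] by metis
    then have disj: "?P ` ?I \<inter> (?R \<circ> ?P) ` ?I = {}" unfolding o_def by blast
    \<comment> \<open>The interval \<open>{3..n - 3}\<close> has \<open>n - 5\<close> elements; it
      is empty for \<open>n = 5\<close>.\<close>
    have "card ?I = 2 ^ (n - 5)" using n by (simp add: card_Pow)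
    then have "card (?P ` ?I \<union> (?R \<circ> ?P) ` ?I) = 2 * 2 ^ (n - 5)"
      using card_Un_disjoint[OF _ _ disj] unfolding card_image[OF inj(1)] card_image[OF inj(2)] by simp
    also have "\<dots> = 2 ^ Suc (n - 5)" by simp
    also have "Suc (n - 5) = n - 4" using n by simp
    finally have "2 ^ (n - 4) \<le> card T" using card_mono[OF fin sub] by simp
    then have "real (2 ^ (n - 4)) \<le> real (card T)" by (simp only: of_nat_le_iff)
    also have "real (2 ^ (n - 4)) = 2 powr real (n - 4)" by (simp add: powr_realpow)
    also have "real (n - 4) = real n - 4" using n by (subst of_nat_diff) auto
    finally show ?thesis .
  qed
  then show ?thesis using alternating_pattern(1) unfolding T_def by blast
qed

end
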